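(* Let $K>0$ be fixed, and for each $n$ let $n_1<n_2$ be positive integers with $n_2\le n\le Kn_1$. Let $\hat f_2$ be the corresponding general $2$-jackknife estimator. Then: 1. if $f(p)=-p\ln p$, then $\|\mathbb{E}_p\hat f_2-f(p)\|\lesssim\frac1n$; 2. if $f(p)=p^\alpha$ with $0<\alpha<1$, then $\|\mathbb{E}_p\hat f_2-f(p)\|\lesssim_\alpha\frac1{n^\alpha}$. Moreover, let $\hat f_2$ be either the delete-$1$ $2$-jackknife ($n_1=n-1$, $n_2=n$), or a $2$-jackknife satisfying the bounded coefficients condition $|C_1|+|C_2|\le C$ for a constant $C$ not depending on $n$. Then: 1. if $f(p)=-p\ln p$, then $\|\mathbb{E}_p\hat f_2-f(p)\|\gtrsim\frac1n$; 2. if $f(p)=p^\alpha$ with $0<\alpha<1$, then $\|\mathbb{E}_p\hat f_2-f(p)\|\gtrsim_\alpha\frac1{n^\alpha}$.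
   Context: All norms are supremum norms over $p\in[0,1]$; $0\ln0=0$. The general $2$-jackknife estimator is $\hat f_2=C_1\mathbb{U}_{n,1}+C_2\mathbb{U}_{n,2}$ with $C_1=\frac{n_1}{n_1-n_2}$, $C_2=\frac{n_2}{n_2-n_1}$, where $\mathbb{U}_{n,i}$ is the average of $f\big(\frac1{n_i}\sum_{k\in S}X_k\big)$ over all subsets $S\subset\{1,\dots,n\}$ of size $n_i$, and $X_1,\dots,X_n$ are i.i.d. $\mathrm{Bernoulli}(p)$. Thus $\mathbb{E}_p\hat f_2=C_1\mathbb{E}_pf(\hat p_{n_1})+C_2\mathbb{E}_pf(\hat p_{n_2})$, where $m\hat p_m\sim\mathrm{Binomial}(m,p)$. $a\lesssim_\theta b$ means $a\le Mb$ for all $n$ with a constant $M>0$ depending only on $\theta$ (no subscript: absolute constant); $a\gtrsim_\theta b$ means $b\lesssim_\theta a$. The constants $K$ and $C$ are fixed, and the implied constants may also depend on them. *)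

theory Defs
  imports "HOL-Probability.Probability"
begin

text \<open>A sample of size n is a function on the index set {1..n} (the indices outside get a dummy
  value); the observation \<open>X\<^sub>k\<close> is \<open>of_bool (x k)\<close>.\<close>

definition iid_bernoulli :: "nat \<Rightarrow> real \<Rightarrow> (nat \<Rightarrow> bool) pmf" where
  "iid_bernoulli n p = Pi_pmf {1..n} False (\<lambda>_. bernoulli_pmf p)"

definition U_stat :: "(real \<Rightarrow> real) \<Rightarrow> nat \<Rightarrow> nat \<Rightarrow> (nat \<Rightarrow> bool) \<Rightarrow> real" where
  "U_stat f n m x =
     (\<Sum>S | S \<subseteq> {1..n} \<and> card S = m. f ((\<Sum>k\<in>S. of_bool (x k)) / real m)) / real (n choose m)"

definition coeff1 :: "nat \<Rightarrow> nat \<Rightarrow> real" where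
  "coeff1 n1 n2 = real n1 / (real n1 - real n2)"

definition coeff2 :: "nat \<Rightarrow> nat \<Rightarrow> real" where
  "coeff2 n1 n2 = real n2 / (real n2 - real n1)"

definition jackknife2 :: "(real \<Rightarrow> real) \<Rightarrow> nat \<Rightarrow> nat \<Rightarrow> nat \<Rightarrow> (nat \<Rightarrow> bool) \<Rightarrow> real" where
  "jackknife2 f n n1 n2 x = coeff1 n1 n2 * U_stat f n n1 x + coeff2 n1 n2 * U_stat f n n2 x"

definition jackknife2_bias :: "(real \<Rightarrow> real) \<Rightarrow> nat \<Rightarrow> nat \<Rightarrow> nat \<Rightarrow> real \<Rightarrow> real" where
  "jackknife2_bias f n n1 n2 p =
     measure_pmf.expectation (iid_bernoulli n p) (jackknife2 f n n1 n2) - f p"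

text \<open>Real-valued supremum: meaningful only for functions that are bounded on the unit interval,
  as \<open>jackknife2_bias f n n1 n2\<close> is whenever f is bounded there.\<close>

definition sup_norm :: "(real \<Rightarrow> real) \<Rightarrow> real" where
  "sup_norm g = (SUP p\<in>{0..1}. \<bar>g p\<bar>)"

definition admissible :: "real \<Rightarrow> nat \<Rightarrow> nat \<Rightarrow> nat \<Rightarrow> bool" where
  "admissible K n n1 n2 \<longleftrightarrow> 0 < n1 \<and> n1 < n2 \<and> n2 \<le> n \<and> real n \<le> K * real n1"

definition delete_one :: "nat \<Rightarrow> nat \<Rightarrow> nat \<Rightarrow> bool" where
  "delete_one n n1 n2 \<longleftrightarrow> n \<ge> 2 \<and> n1 = n - 1 \<and> n2 = n"

definition bounded_coeffs :: "real \<Rightarrow> nat \<Rightarrow> nat \<Rightarrow> bool" where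
  "bounded_coeffs C n1 n2 \<longleftrightarrow> \<bar>coeff1 n1 n2\<bar> + \<bar>coeff2 n1 n2\<bar> \<le> C"

text \<open>The convention \<open>0 ln 0 = 0\<close> holds since \<open>0 * ln 0 = 0\<close>.\<close>

definition neg_p_ln_p :: "real \<Rightarrow> real" where
  "neg_p_ln_p p = - p * ln p"

end

theory Submission
  imports Defs
begin

text \<open>
  Let \<open>B\<^sub>m f(p) = E f(X\<^sub>m/m)\<close> with \<open>X\<^sub>m\<close> binomial. Summation by parts makes the expectation of the
  2-jackknife the average over \<open>n1 \<le> m < n2\<close> of \<open>(m+1) B\<^sub>m\<^sub>+\<^sub>1 f - m B\<^sub>m f = B\<^sub>m\<^sub>+\<^sub>1 J\<^sub>m f\<close>, where
  \<open>J\<^sub>m f = f + m (f - L\<^sub>m f)\<close> and \<open>L\<^sub>m f(x)\<close> is the mean of f over the success fractions left when one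
  of \<open>m+1\<close> observations with success fraction x is deleted.

  Both functions have the form \<open>f(x) = x h(x)\<close> with \<open>h'(x) = -c x\<^sup>\<alpha>\<^sup>-\<^sup>2\<close>, the entropy being the case
  \<open>\<alpha> = 1\<close>. So f is concave, and convexity of h under the size-biased law gives
  \<open>0 \<le> f(\<mu>) - E f(Y) \<le> \<mu> (h(\<mu>) - h(\<mu> + Var Y / \<mu>))\<close> for every \<open>Y \<ge> 0\<close> with mean \<open>\<mu> > 0\<close>. For
  binomial Y this bounds \<open>f - B\<^sub>N f\<close>, and for the two-point law of the deletion it bounds \<open>J\<^sub>m f - f\<close>
  on the grid of multiples of \<open>1/N\<close>, both by multiples of \<open>N\<^sup>-\<^sup>\<alpha>\<close>, where \<open>N = m+1\<close>.

  Near 0 the estimator cannot follow the singularity of h: on the grid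
  \<open>J\<^sub>m f(x) \<le> x (h(1/n) + 2 c n\<^sup>1\<^sup>-\<^sup>\<alpha>)\<close>, so its expectation at \<open>p = e\<^sup>-\<^sup>3/n\<close> is at most
  \<open>p (h(1/n) + 2 c n\<^sup>1\<^sup>-\<^sup>\<alpha>)\<close>, while \<open>h(p) \<ge> h(1/n) + 3 c n\<^sup>1\<^sup>-\<^sup>\<alpha>\<close>.
\<close>

section \<open>Jensen's inequality under size biasing\<close>

lemma convex_on_sum_size_biased:
  fixes h :: "real \<Rightarrow> real"
  assumes "finite I" and h: "convex_on {0<..} h"
    and w: "\<And>i. i \<in> I \<Longrightarrow> 0 \<le> w i" and y: "\<And>i. i \<in> I \<Longrightarrow> 0 \<le> y i"
    and mean: "(\<Sum>i\<in>I. w i * y i) = \<mu>"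
  shows "\<mu> * h ((\<Sum>i\<in>I. w i * (y i)\<^sup>2) / \<mu>) \<le> (\<Sum>i\<in>I. w i * (y i * h (y i)))"
proof (cases "\<mu> = 0")
  case True
  then have "w i * y i = 0" if "i \<in> I" for i
    using mean sum_nonneg_eq_0_iff[OF \<open>finite I\<close>, of "\<lambda>i. w i * y i"] w y that by simp
  then have "(\<Sum>i\<in>I. w i * (y i * h (y i))) = 0"
    by (intro sum.neutral) auto
  with True show ?thesis
    by simp
next
  case False
  moreover have "0 \<le> \<mu>"
    unfolding mean[symmetric] using w y by (intro sum_nonneg) auto
  ultimately have \<mu>: "0 < \<mu>"
    by simp
  define J where "J = {i \<in> I. 0 < y i}"
  have restrict: "(\<Sum>i\<in>I. w i * y i * g i) = (\<Sum>i\<in>J. w i * y i * g i)" for g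
    unfolding J_def using \<open>finite I\<close> y
    by (intro sum.mono_neutral_right) (auto simp: order.order_iff_strict)
  have total: "(\<Sum>i\<in>J. w i * y i / \<mu>) = 1"
    using restrict[of "\<lambda>_. 1"] mean \<mu> by (simp flip: sum_divide_distrib)
  then have "J \<noteq> {}"
    by auto
  have "h (\<Sum>i\<in>J. (w i * y i / \<mu>) *\<^sub>R y i) \<le> (\<Sum>i\<in>J. w i * y i / \<mu> * h (y i))"
    using \<open>finite I\<close> \<open>J \<noteq> {}\<close> total w \<mu> by (intro convex_on_sum[OF _ _ h]) (auto simp: J_def)
  moreover have "(\<Sum>i\<in>J. (w i * y i / \<mu>) *\<^sub>R y i) = (\<Sum>i\<in>I. w i * (y i)\<^sup>2) / \<mu>"
    using restrict[of y] by (simp add: sum_divide_distrib power2_eq_square mult.assoc)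
  moreover have "(\<Sum>i\<in>J. w i * y i / \<mu> * h (y i)) = (\<Sum>i\<in>I. w i * (y i * h (y i))) / \<mu>"
    using restrict[of "\<lambda>i. h (y i)"] by (simp add: sum_divide_distrib mult.assoc)
  ultimately show ?thesis
    using \<mu> by (simp add: pos_le_divide_eq mult.commute)
qed

section \<open>Bernstein operators\<close>

definition bernstein_op :: "(real \<Rightarrow> real) \<Rightarrow> nat \<Rightarrow> real \<Rightarrow> real" where
  "bernstein_op f m p = (\<Sum>k\<le>m. Bernstein m k p * f (real k / real m))"

lemma bernstein_op_mono:
  assumes "p \<in> {0..1}" "\<And>k. k \<le> m \<Longrightarrow> f (real k / real m) \<le> g (real k / real m)"
  shows "bernstein_op f m p \<le> bernstein_op g m p"
  unfolding bernstein_op_def using assms by (intro sum_mono mult_left_mono Bernstein_nonneg) auto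

lemma bernstein_op_diff:
  "bernstein_op (\<lambda>x. f x - g x) m p = bernstein_op f m p - bernstein_op g m p"
  by (simp add: bernstein_op_def right_diff_distrib sum_subtractf)

lemma bernstein_op_cmult: "bernstein_op (\<lambda>x. a * f x) m p = a * bernstein_op f m p"
  by (simp add: bernstein_op_def sum_distrib_left mult.left_commute)

lemma bernstein_op_add_const: "bernstein_op (\<lambda>x. f x + a) m p = bernstein_op f m p + a"
  by (simp add: bernstein_op_def distrib_left sum.distrib flip: sum_distrib_right)

lemma bernstein_op_zero: "bernstein_op f m 0 = f 0"
  by (simp add: bernstein_op_def Bernstein_def power_0_left if_distrib if_distribR cong: if_cong)

lemma bernstein_op_ident: "1 \<le> m \<Longrightarrow> bernstein_op (\<lambda>x. x) m p = p"
  using sum_k_Bernstein[of m p]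
  by (simp add: bernstein_op_def mult.commute flip: sum_divide_distrib)

lemma bernstein_op_square:
  assumes "1 \<le> m"
  shows "bernstein_op (\<lambda>x. x\<^sup>2) m p = p\<^sup>2 + p * (1 - p) / real m"
proof -
  have "(\<Sum>k\<le>m. Bernstein m k p * (real k)\<^sup>2)
      = (\<Sum>k\<le>m. real k * (real k - 1) * Bernstein m k p) + (\<Sum>k\<le>m. real k * Bernstein m k p)"
    unfolding sum.distrib[symmetric]
    by (intro sum.cong refl) (simp add: algebra_simps power2_eq_square)
  also have "\<dots> = real m * (real m - 1) * p\<^sup>2 + real m * p"
    by simp
  finally show ?thesis
    using assms
    by (simp add: bernstein_op_def power_divide flip: sum_divide_distrib)
      (simp add: field_simps power2_eq_square)
qed

lemma bernstein_op_le_concave: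
  assumes "concave_on {0..} f" "1 \<le> m" "p \<in> {0..1}"
  shows "bernstein_op f m p \<le> f p"
  using concave_on_sum[of "{..m}" "{0..}" f "\<lambda>k. Bernstein m k p" "\<lambda>k. real k / real m"]
    assms bernstein_op_ident[of m p]
  by (simp add: bernstein_op_def Bernstein_nonneg)

lemma bernstein_op_ge_size_biased:
  assumes "convex_on {0<..} h" "1 \<le> m" "p \<in> {0<..1}"
  shows "p * h (p + (1 - p) / real m) \<le> bernstein_op (\<lambda>x. x * h x) m p"
proof -
  have "p * h (bernstein_op (\<lambda>x. x\<^sup>2) m p / p) \<le> bernstein_op (\<lambda>x. x * h x) m p"
    unfolding bernstein_op_def[of "\<lambda>x. x\<^sup>2"] bernstein_op_def[of "\<lambda>x. x * h x"]
    using assms bernstein_op_ident[of m p]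
    by (intro convex_on_sum_size_biased) (auto simp: bernstein_op_def Bernstein_nonneg)
  moreover have "bernstein_op (\<lambda>x. x\<^sup>2) m p / p = p + (1 - p) / real m"
    unfolding bernstein_op_square[OF assms(2)] using assms(3)
    by (simp add: add_divide_distrib power2_eq_square)
  ultimately show ?thesis
    by simp
qed

section \<open>Deleting one observation\<close>

text \<open>If x is the success fraction k/(m+1), then \<open>x - (1 - x)/m = (k - 1)/m\<close> and \<open>x + x/m = k/m\<close>.
  For x = 0 the first point is negative, but has weight 0.\<close>

definition leave_one_out_mean :: "(real \<Rightarrow> real) \<Rightarrow> nat \<Rightarrow> real \<Rightarrow> real" where
  "leave_one_out_mean f m x = x * f (x - (1 - x) / real m) + (1 - x) * f (x + x / real m)"

definition delete_one_jackknife :: "(real \<Rightarrow> real) \<Rightarrow> nat \<Rightarrow> real \<Rightarrow> real" where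
  "delete_one_jackknife f m x = real (Suc m) * f x - real m * leave_one_out_mean f m x"

lemma leave_one_out_mean_grid:
  assumes "1 \<le> m"
  shows "leave_one_out_mean f m (real k / real (Suc m)) =
    real k / real (Suc m) * f ((real k - 1) / real m)
      + (1 - real k / real (Suc m)) * f (real k / real m)"
proof -
  define x where "x = real k / real (Suc m)"
  have k: "real k = x * (real m + 1)"
    by (simp add: x_def add.commute)
  have "x - (1 - x) / real m = (real k - 1) / real m" "x + x / real m = real k / real m"
    using assms unfolding k by (simp_all add: field_simps)
  then show ?thesis
    unfolding x_def[symmetric] by (simp only: leave_one_out_mean_def)
qed

lemma delete_one_jackknife_zero [simp]: "delete_one_jackknife f m 0 = f 0"
  by (simp add: delete_one_jackknife_def leave_one_out_mean_def algebra_simps)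

lemma grid_point_cases:
  assumes "k \<le> Suc m"
  obtains (zero) "real k / real (Suc m) = 0"
  | (positive) "1 / real (Suc m) \<le> real k / real (Suc m)" "real k / real (Suc m) \<le> 1"
  using assms by (cases "k = 0") (auto simp: field_simps)

lemma Bernstein_Suc_Suc:
  "Bernstein (Suc m) (Suc k) p * (real (Suc k) / real (Suc m)) = p * Bernstein m k p"
proof -
  have "real (Suc m choose Suc k) * real (Suc k) = real (Suc m) * real (m choose k)"
    using Suc_times_binomial_eq[of m k] by (simp only: of_nat_mult[symmetric])
  then have choose: "real (m choose k) = real (Suc m choose Suc k) * (real (Suc k) / real (Suc m))"
    by (simp add: field_simps del: of_nat_Suc binomial_Suc_Suc)
  show ?thesis
    unfolding Bernstein_def choose by (simp add: mult_ac del: of_nat_Suc binomial_Suc_Suc)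
qed

lemma Bernstein_Suc:
  assumes "k \<le> m"
  shows "Bernstein (Suc m) k p * (1 - real k / real (Suc m)) = (1 - p) * Bernstein m k p"
proof -
  have "real (Suc m - k) * real (Suc m choose k) = real (Suc m) * real (m choose k)"
    using binomial_absorb_comp[of "Suc m" k] by (simp only: of_nat_mult[symmetric] diff_Suc_1)
  then have "real (Suc m choose k) * (1 - real k / real (Suc m)) = real (m choose k)"
    using assms by (simp add: of_nat_diff field_simps)
  moreover have "(1 - p) ^ (Suc m - k) = (1 - p) * (1 - p) ^ (m - k)"
    using assms by (simp add: Suc_diff_le)
  ultimately show ?thesis
    by (simp add: Bernstein_def mult_ac del: of_nat_Suc)
qed

lemma bernstein_op_leave_one_out_mean:
  assumes "1 \<le> m"
  shows "bernstein_op (leave_one_out_mean f m) (Suc m) p = bernstein_op f m p"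
proof -
  let ?B = "\<lambda>k. Bernstein (Suc m) k p" and ?x = "\<lambda>k. real k / real (Suc m)"
  have "bernstein_op (leave_one_out_mean f m) (Suc m) p
      = (\<Sum>k\<le>Suc m. ?B k * ?x k * f ((real k - 1) / real m))
        + (\<Sum>k\<le>Suc m. ?B k * (1 - ?x k) * f (real k / real m))"
    unfolding bernstein_op_def leave_one_out_mean_grid[OF assms]
    by (simp only: distrib_left sum.distrib mult.assoc)
  also have "(\<Sum>k\<le>Suc m. ?B k * ?x k * f ((real k - 1) / real m))
      = (\<Sum>k\<le>m. ?B (Suc k) * ?x (Suc k) * f (real k / real m))"
    by (subst sum.atMost_Suc_shift) simp
  also have "\<dots> = p * bernstein_op f m p"
    unfolding Bernstein_Suc_Suc by (simp add: bernstein_op_def sum_distrib_left mult.assoc)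
  also have "(\<Sum>k\<le>Suc m. ?B k * (1 - ?x k) * f (real k / real m))
      = (\<Sum>k\<le>m. ?B k * (1 - ?x k) * f (real k / real m))"
    by simp
  also have "\<dots> = (1 - p) * bernstein_op f m p"
    unfolding bernstein_op_def sum_distrib_left
    by (intro sum.cong refl) (simp only: Bernstein_Suc atMost_iff mult.assoc)
  finally show ?thesis
    by (simp add: algebra_simps)
qed

lemma bernstein_op_delete_one_jackknife:
  assumes "1 \<le> m"
  shows "bernstein_op (delete_one_jackknife f m) (Suc m) p
    = real (Suc m) * bernstein_op f (Suc m) p - real m * bernstein_op f m p"
  unfolding delete_one_jackknife_def bernstein_op_diff bernstein_op_cmult
    bernstein_op_leave_one_out_mean[OF assms] ..

lemma leave_one_out_points_nonneg:
  fixes x :: real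
  assumes "1 \<le> m" "1 / real (Suc m) \<le> x"
  shows "0 \<le> x - (1 - x) / real m" "0 \<le> x + x / real m" "0 < x"
proof -
  have "0 < 1 / real (Suc m)"
    by simp
  with assms(2) show "0 < x"
    by linarith
  then show "0 \<le> x + x / real m"
    by simp
  show "0 \<le> x - (1 - x) / real m"
    using assms by (simp add: field_simps)
qed

lemma leave_one_out_mean_le_concave:
  assumes f: "concave_on {0..} f" and m: "1 \<le> m" and x: "1 / real (Suc m) \<le> x" "x \<le> 1"
  shows "leave_one_out_mean f m x \<le> f x"
proof -
  note nonneg = leave_one_out_points_nonneg[OF m x(1)]
  have "(1 - x) * (x + x / real m) + x * (x - (1 - x) / real m) = x"
    using m by (simp add: field_simps)
  then show ?thesis
    using concave_onD[OF f, of x "x + x / real m" "x - (1 - x) / real m"] nonneg x(2)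
    by (simp add: leave_one_out_mean_def add.commute)
qed

lemma leave_one_out_mean_ge_size_biased:
  assumes h: "convex_on {0<..} h" and m: "1 \<le> m" and x: "1 / real (Suc m) \<le> x" "x \<le> 1"
  shows "x * h (x + (1 - x) / (real m)\<^sup>2) \<le> leave_one_out_mean (\<lambda>y. y * h y) m x"
proof -
  define w where "w = (\<lambda>success. if success then x else 1 - x)"
  define y where "y = (\<lambda>success. if success then x - (1 - x) / real m else x + x / real m)"
  note nonneg = leave_one_out_points_nonneg[OF m x(1)]
  have mean: "(\<Sum>success\<in>UNIV. w success * y success) = x"
    using m by (simp add: w_def y_def UNIV_bool field_simps)
  have "(\<Sum>success\<in>UNIV. w success * (y success)\<^sup>2) / x = x + (1 - x) / (real m)\<^sup>2"
    using m nonneg(3) by (simp add: w_def y_def UNIV_bool field_simps power2_eq_square)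
  moreover have "x * h ((\<Sum>success\<in>UNIV. w success * (y success)\<^sup>2) / x)
      \<le> (\<Sum>success\<in>UNIV. w success * (y success * h (y success)))"
    using nonneg x(2) by (intro convex_on_sum_size_biased h mean) (auto simp: w_def y_def)
  ultimately show ?thesis
    by (simp add: leave_one_out_mean_def w_def y_def UNIV_bool add.commute)
qed

section \<open>The expectation of the 2-jackknife\<close>

lemma finite_set_pmf_iid_bernoulli: "finite (set_pmf (iid_bernoulli n p))"
  unfolding iid_bernoulli_def
  by (rule finite_subset[OF set_Pi_pmf_subset']) auto

lemma expectation_subset_mean:
  assumes "p \<in> {0..1}" "S \<subseteq> {1..n}" "card S = m"
  shows "measure_pmf.expectation (iid_bernoulli n p) (\<lambda>x. f ((\<Sum>k\<in>S. of_bool (x k)) / real m))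
         = bernstein_op f m p"
proof -
  have fin: "finite S"
    using assms(2) finite_subset by blast
  have count: "(\<Sum>k\<in>S. of_bool (x k)) = real (card {k \<in> S. x k})" for x :: "nat \<Rightarrow> bool"
    using fin by (simp add: of_bool_def sum.If_cases Int_def)
  have "binomial_pmf m p =
      map_pmf (\<lambda>x. card {k \<in> S. x k}) (Pi_pmf S False (\<lambda>_. bernoulli_pmf p))"
    by (rule binomial_pmf_altdef') (use assms fin in auto)
  also have "\<dots> = map_pmf (\<lambda>x. card {k \<in> S. x k}) (iid_bernoulli n p)"
    unfolding iid_bernoulli_def
    by (subst Pi_pmf_subset[of "{1..n}" S])
      (use assms(2) in \<open>auto simp: pmf.map_comp o_def
        intro!: map_pmf_cong arg_cong[where f = card]\<close>)
  finally have "measure_pmf.expectation (binomial_pmf m p) (\<lambda>k. f (real k / real m))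
      = measure_pmf.expectation (iid_bernoulli n p) (\<lambda>x. f (real (card {k \<in> S. x k}) / real m))"
    by simp
  then show ?thesis
    using assms(1) by (simp add: count expectation_binomial_pmf' bernstein_op_def Bernstein_def)
qed

lemma expectation_U_stat:
  assumes "p \<in> {0..1}" "m \<le> n"
  shows "measure_pmf.expectation (iid_bernoulli n p) (U_stat f n m) = bernstein_op f m p"
proof -
  let ?\<S> = "{S. S \<subseteq> {1..n} \<and> card S = m}"
  have card: "card ?\<S> = n choose m"
    using n_subsets[of "{1..n}" m] by simp
  have "measure_pmf.expectation (iid_bernoulli n p) (U_stat f n m)
      = (\<Sum>S\<in>?\<S>. measure_pmf.expectation (iid_bernoulli n p)
            (\<lambda>x. f ((\<Sum>k\<in>S. of_bool (x k)) / real m))) / real (n choose m)"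
    unfolding U_stat_def
    by (simp add: Bochner_Integration.integral_sum integrable_measure_pmf_finite
        finite_set_pmf_iid_bernoulli)
  also have "\<dots> = (\<Sum>S\<in>?\<S>. bernstein_op f m p) / real (n choose m)"
    using assms(1) by (intro arg_cong2[where f = "(/)"] sum.cong refl expectation_subset_mean) auto
  also have "\<dots> = bernstein_op f m p"
    unfolding sum_constant card using assms(2) by simp
  finally show ?thesis .
qed

lemma jackknife2_bias_eq_average:
  assumes "p \<in> {0..1}" "0 < n1" "n1 < n2" "n2 \<le> n"
  shows "jackknife2_bias f n n1 n2 p =
    (\<Sum>m = n1..<n2. bernstein_op (delete_one_jackknife f m) (Suc m) p) / real (n2 - n1) - f p"
proof -
  let ?E = "\<lambda>m. real m * bernstein_op f m p"
  have "jackknife2_bias f n n1 n2 p =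
      coeff1 n1 n2 * bernstein_op f n1 p + coeff2 n1 n2 * bernstein_op f n2 p - f p"
    unfolding jackknife2_bias_def jackknife2_def
    using assms
    by (simp add: integrable_measure_pmf_finite finite_set_pmf_iid_bernoulli expectation_U_stat)
  also have "\<dots> = (?E n2 - ?E n1) / real (n2 - n1) - f p"
    using assms
    by (simp add: coeff1_def coeff2_def of_nat_diff divide_simps) (simp add: algebra_simps)
  also have "?E n2 - ?E n1 = (\<Sum>m = n1..<n2. ?E (Suc m) - ?E m)"
    using assms by (subst sum_Suc_diff') auto
  also have "\<dots> = (\<Sum>m = n1..<n2. bernstein_op (delete_one_jackknife f m) (Suc m) p)"
    using assms by (intro sum.cong) (auto simp: bernstein_op_delete_one_jackknife)
  finally show ?thesis .
qed

lemma jackknife2_bias_le: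
  assumes "p \<in> {0..1}" "0 < n1" "n1 < n2" "n2 \<le> n"
    and "\<And>m. m \<in> {n1..<n2} \<Longrightarrow> bernstein_op (delete_one_jackknife f m) (Suc m) p \<le> f p + b"
  shows "jackknife2_bias f n n1 n2 p \<le> b"
  using sum_bounded_above[of "{n1..<n2}", OF assms(5)] assms(3)
  unfolding jackknife2_bias_eq_average[OF assms(1-4)]
  by (simp add: pos_divide_le_eq mult.commute diff_le_eq add.commute)

lemma jackknife2_bias_ge:
  assumes "p \<in> {0..1}" "0 < n1" "n1 < n2" "n2 \<le> n"
    and "\<And>m. m \<in> {n1..<n2} \<Longrightarrow> f p + b \<le> bernstein_op (delete_one_jackknife f m) (Suc m) p"
  shows "b \<le> jackknife2_bias f n n1 n2 p"
  using sum_bounded_below[of "{n1..<n2}", OF assms(5)] assms(3)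
  unfolding jackknife2_bias_eq_average[OF assms(1-4)]
  by (simp add: pos_le_divide_eq mult.commute le_diff_eq add.commute)

section \<open>Functions with a power singularity at 0\<close>

text \<open>In terms of f alone the last condition says \<open>f''(x) = -\<alpha> c x\<^sup>\<alpha>\<^sup>-\<^sup>2\<close>.\<close>

locale power_singularity =
  fixes f h :: "real \<Rightarrow> real" and \<alpha> c :: real
  assumes exponent: "0 < \<alpha>" "\<alpha> \<le> 1"
    and scale: "0 < c"
    and f_eq: "0 \<le> x \<Longrightarrow> f x = x * h x"
    and h_deriv: "0 < x \<Longrightarrow> (h has_real_derivative - c * x powr (\<alpha> - 2)) (at x)"
begin

lemma h_antimono:
  assumes "0 < x" "x \<le> y"
  shows "h y \<le> h x"
proof (rule DERIV_nonpos_imp_nonincreasing[OF assms(2)])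
  fix t assume "x \<le> t"
  then show "\<exists>D. (h has_real_derivative D) (at t) \<and> D \<le> 0"
    using h_deriv[of t] assms(1) scale by (intro exI[of _ "- c * t powr (\<alpha> - 2)"]) auto
qed

lemma h_convex: "convex_on {0<..} h"
proof (rule convex_on_realI)
  fix x y :: real
  assume "x \<in> {0<..}" "x \<le> y"
  then show "- c * x powr (\<alpha> - 2) \<le> - c * y powr (\<alpha> - 2)"
    using exponent scale by (auto intro!: mult_left_mono powr_mono2')
qed (use h_deriv in auto)

lemma h_diff_le_tangent:
  assumes "0 < x" "0 \<le> \<delta>"
  shows "h x - h (x + \<delta>) \<le> c * x powr (\<alpha> - 2) * \<delta>"
proof -
  have "- c * x powr (\<alpha> - 2) * (x + \<delta> - x) \<le> h (x + \<delta>) - h x"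
    using assms h_deriv[OF assms(1), THEN has_field_derivative_at_within]
    by (intro convex_on_imp_above_tangent[OF h_convex]) (auto simp: interior_open)
  then show ?thesis
    by simp
qed

text \<open>Unlike the tangent bound this one is uniform in x, because \<open>x t\<^sup>\<alpha>\<^sup>-\<^sup>2 \<le> (t - x)\<^sup>\<alpha>\<^sup>-\<^sup>1\<close>.\<close>

lemma h_diff_le_uniform:
  assumes "0 < x" "0 \<le> \<delta>"
  shows "x * (h x - h (x + \<delta>)) \<le> c / \<alpha> * \<delta> powr \<alpha>"
proof -
  define g where "g = (\<lambda>t. x * h t + c / \<alpha> * (t - x) powr \<alpha>)"
  have "g x \<le> g (x + \<delta>)"
  proof (rule DERIV_nonneg_imp_increasing_open[of x "x + \<delta>" g])
    fix t assume t: "x < t"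
    have "(g has_real_derivative c * (t - x) powr (\<alpha> - 1) - c * (x * t powr (\<alpha> - 2))) (at t)"
      unfolding g_def using t assms(1) exponent
      by (auto intro!: derivative_eq_intros h_deriv simp: field_simps)
    moreover have "x * t powr (\<alpha> - 2) \<le> t * t powr (\<alpha> - 2)"
      using t by (intro mult_right_mono) auto
    moreover have "t * t powr (\<alpha> - 2) = t powr (\<alpha> - 1)"
      using t assms(1) by (simp add: powr_mult_base)
    moreover have "t powr (\<alpha> - 1) \<le> (t - x) powr (\<alpha> - 1)"
      using t assms(1) exponent by (intro powr_mono2') auto
    ultimately show "\<exists>D. (g has_real_derivative D) (at t) \<and> 0 \<le> D"
      using scale by (intro exI conjI) (auto simp flip: right_diff_distrib)
  next
    show "continuous_on {x..x + \<delta>} g"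
      unfolding g_def using assms(1) exponent
      by (intro continuous_intros continuous_on_powr' DERIV_continuous_on[OF
            has_field_derivative_at_within[OF h_deriv]]) auto
  qed (use assms in simp)
  then show ?thesis
    by (simp add: g_def algebra_simps)
qed

text \<open>The logarithm arises from \<open>s\<^sup>\<alpha>\<^sup>-\<^sup>2 \<ge> y\<^sup>\<alpha>\<^sup>-\<^sup>1 / s\<close> for \<open>s \<le> y\<close>.\<close>

lemma h_diff_ge_ln:
  assumes "0 < x" "x \<le> y"
  shows "c * y powr (\<alpha> - 1) * ln (y / x) \<le> h x - h y"
proof -
  define g where "g = (\<lambda>s. h s + c * y powr (\<alpha> - 1) * ln s)"
  have "g y \<le> g x"
  proof (rule DERIV_nonpos_imp_nonincreasing[OF assms(2)])
    fix s assume s: "x \<le> s" "s \<le> y"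
    have "(g has_real_derivative c * (y powr (\<alpha> - 1) - s powr (\<alpha> - 1)) / s) (at s)"
      unfolding g_def using s assms(1)
      by (auto intro!: derivative_eq_intros h_deriv
          simp: field_simps powr_diff power2_eq_square)
    moreover have "y powr (\<alpha> - 1) \<le> s powr (\<alpha> - 1)"
      using s assms(1) exponent by (intro powr_mono2') auto
    ultimately show "\<exists>D. (g has_real_derivative D) (at s) \<and> D \<le> 0"
      using s assms(1) scale
      by (intro exI conjI) (auto intro!: divide_nonpos_pos mult_nonneg_nonpos)
  qed
  then show ?thesis
    using assms by (simp add: g_def ln_div algebra_simps)
qed

lemma f_concave_pos: "concave_on {0<..} f"
proof (rule f''_le0_imp_concave)
  fix x :: real
  assume "x \<in> {0<..}"
  then have x: "0 < x"
    by simp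
  have "((\<lambda>x. x * h x) has_real_derivative h x - c * x powr (\<alpha> - 1)) (at x)"
    using x by (auto intro!: derivative_eq_intros h_deriv simp: powr_mult_base mult_ac)
  then show "(f has_real_derivative h x - c * x powr (\<alpha> - 1)) (at x)"
    by (rule has_field_derivative_transform_within_open[of _ _ _ "{0<..}"]) (use x f_eq in auto)
  show "((\<lambda>x. h x - c * x powr (\<alpha> - 1)) has_real_derivative - \<alpha> * c * x powr (\<alpha> - 2)) (at x)"
    using x by (auto intro!: derivative_eq_intros h_deriv simp: algebra_simps)
  show "- \<alpha> * c * x powr (\<alpha> - 2) \<le> 0"
    using exponent scale by simp
qed simp

lemma f_concave: "concave_on {0..} f"
proof (rule concave_on_linorderI)
  fix t x y :: real
  assume t: "0 < t" "t < 1" and xy: "x \<in> {0..}" "x < y"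
  show "(1 - t) * f x + t * f y \<le> f ((1 - t) *\<^sub>R x + t *\<^sub>R y)"
  proof (cases "x = 0")
    case True
    have "t * y * h y \<le> t * y * h (t * y)"
      using t xy by (intro mult_left_mono h_antimono) (auto simp: mult_left_le_one_le)
    with True t xy show ?thesis
      by (simp add: f_eq)
  next
    case False
    with t xy show ?thesis
      by (intro concave_onD[OF f_concave_pos]) auto
  qed
qed simp

lemma bernstein_op_ge:
  assumes "1 \<le> N" "p \<in> {0..1}"
  shows "f p - c / \<alpha> / real N powr \<alpha> \<le> bernstein_op f N p"
proof (cases "p = 0")
  case True
  then show ?thesis
    using exponent scale by (simp add: bernstein_op_zero)
next
  case False
  with assms have p: "p \<in> {0<..1}"
    by simp
  have "f p - p * h (p + (1 - p) / real N) \<le> c / \<alpha> * ((1 - p) / real N) powr \<alpha>"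
    using h_diff_le_uniform[of p "(1 - p) / real N"] p by (simp add: f_eq right_diff_distrib)
  also have "\<dots> \<le> c / \<alpha> * (1 / real N) powr \<alpha>"
    using p exponent scale by (intro mult_left_mono powr_mono2 divide_right_mono) auto
  also have "\<dots> = c / \<alpha> / real N powr \<alpha>"
    by (simp add: powr_divide)
  finally have "f p - p * h (p + (1 - p) / real N) \<le> c / \<alpha> / real N powr \<alpha>" .
  moreover have "p * h (p + (1 - p) / real N) \<le> bernstein_op f N p"
    using bernstein_op_ge_size_biased[OF h_convex assms(1) p] by (simp add: bernstein_op_def f_eq)
  ultimately show ?thesis
    by simp
qed

lemma delete_one_jackknife_ge:
  assumes "1 \<le> m" "k \<le> Suc m"
  shows "f (real k / real (Suc m)) \<le> delete_one_jackknife f m (real k / real (Suc m))"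
  using assms(2)
proof (cases rule: grid_point_cases)
  case positive
  then show ?thesis
    using leave_one_out_mean_le_concave[OF f_concave assms(1) positive]
    by (simp add: delete_one_jackknife_def distrib_right mult_left_mono)
qed simp

lemma delete_one_jackknife_le:
  assumes "1 \<le> m" "k \<le> Suc m"
  shows "delete_one_jackknife f m (real k / real (Suc m))
    \<le> f (real k / real (Suc m)) + 2 * c / real (Suc m) powr \<alpha>"
  using assms(2)
proof (cases rule: grid_point_cases)
  case positive
  define x where "x = real k / real (Suc m)"
  note x = positive[folded x_def]
  note nonneg = leave_one_out_points_nonneg[OF assms(1) x(1)]
  let ?\<delta> = "(1 - x) / (real m)\<^sup>2"
  have "leave_one_out_mean f m x = leave_one_out_mean (\<lambda>y. y * h y) m x"
    using nonneg by (simp add: leave_one_out_mean_def f_eq)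
  then have "f x - leave_one_out_mean f m x \<le> x * (h x - h (x + ?\<delta>))"
    using leave_one_out_mean_ge_size_biased[OF h_convex assms(1) x] nonneg
    by (simp add: f_eq right_diff_distrib)
  also have "\<dots> \<le> x * (c * x powr (\<alpha> - 2) * ?\<delta>)"
    using nonneg x by (intro mult_left_mono h_diff_le_tangent) auto
  also have "\<dots> = c * x powr (\<alpha> - 1) * (1 - x) / (real m)\<^sup>2"
    using nonneg by (simp add: powr_mult_base mult_ac)
  finally have "real m * (f x - leave_one_out_mean f m x)
      \<le> real m * (c * x powr (\<alpha> - 1) * (1 - x) / (real m)\<^sup>2)"
    by (intro mult_left_mono) auto
  also have "\<dots> = c * x powr (\<alpha> - 1) * (1 - x) / real m"
    using assms(1) by (simp add: power2_eq_square)
  also have "\<dots> \<le> c * (1 / real (Suc m)) powr (\<alpha> - 1) * 1 / real m"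
    using nonneg x exponent scale
    by (intro divide_right_mono mult_mono powr_mono2') auto
  also have "\<dots> = c / real (Suc m) powr \<alpha> * (real (Suc m) / real m)"
    by (simp add: powr_divide powr_diff)
  also have "\<dots> \<le> c / real (Suc m) powr \<alpha> * 2"
    using assms(1) scale by (intro mult_left_mono) (auto simp: divide_le_eq)
  finally show ?thesis
    unfolding x_def[symmetric] by (simp add: delete_one_jackknife_def algebra_simps)
qed (use scale in simp)

lemma delete_one_jackknife_le_linear:
  assumes "1 \<le> m" "Suc m \<le> n" "k \<le> Suc m"
  shows "delete_one_jackknife f m (real k / real (Suc m))
    \<le> (h (1 / real n) + 2 * c * real n powr (1 - \<alpha>)) * (real k / real (Suc m))"
  using assms(3)
proof (cases rule: grid_point_cases)
  case positive
  define x where "x = real k / real (Suc m)"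
  note x = positive[folded x_def]
  have pos: "0 < x"
    by (rule leave_one_out_points_nonneg(3)[OF assms(1) x(1)])
  have "1 / real n \<le> 1 / real (Suc m)"
    using assms by (intro divide_left_mono) auto
  then have h_le: "x * h x \<le> x * h (1 / real n)"
    using x pos assms by (intro mult_left_mono h_antimono) auto
  have "2 * c / real (Suc m) powr \<alpha> = 1 / real (Suc m) * (2 * c * real (Suc m) powr (1 - \<alpha>))"
    by (simp add: powr_diff)
  also have "\<dots> \<le> x * (2 * c * real n powr (1 - \<alpha>))"
    using x pos assms exponent scale by (intro mult_mono mult_left_mono powr_mono2) auto
  finally have "delete_one_jackknife f m x
      \<le> x * h (1 / real n) + x * (2 * c * real n powr (1 - \<alpha>))"
    using delete_one_jackknife_le[OF assms(1,3), folded x_def] f_eq[of x] h_le pos by linarith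
  then show ?thesis
    unfolding x_def[symmetric] by (simp only: distrib_left mult.commute[of _ x])
qed (simp add: f_eq)

lemma bernstein_op_delete_one_jackknife_ge:
  assumes "1 \<le> m" "p \<in> {0..1}"
  shows "f p - c / \<alpha> / real (Suc m) powr \<alpha> \<le> bernstein_op (delete_one_jackknife f m) (Suc m) p"
proof -
  have "f p - c / \<alpha> / real (Suc m) powr \<alpha> \<le> bernstein_op f (Suc m) p"
    using assms by (intro bernstein_op_ge) auto
  also have "\<dots> \<le> bernstein_op (delete_one_jackknife f m) (Suc m) p"
    using assms by (intro bernstein_op_mono delete_one_jackknife_ge)
  finally show ?thesis .
qed

lemma bernstein_op_delete_one_jackknife_le:
  assumes "1 \<le> m" "p \<in> {0..1}"
  shows "bernstein_op (delete_one_jackknife f m) (Suc m) p \<le> f p + 2 * c / real (Suc m) powr \<alpha>"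
proof -
  have "bernstein_op (delete_one_jackknife f m) (Suc m) p
      \<le> bernstein_op (\<lambda>x. f x + 2 * c / real (Suc m) powr \<alpha>) (Suc m) p"
    using assms by (intro bernstein_op_mono delete_one_jackknife_le)
  also have "\<dots> = bernstein_op f (Suc m) p + 2 * c / real (Suc m) powr \<alpha>"
    by (rule bernstein_op_add_const)
  also have "bernstein_op f (Suc m) p \<le> f p"
    using assms by (intro bernstein_op_le_concave f_concave) auto
  finally show ?thesis
    by simp
qed

lemma bernstein_op_delete_one_jackknife_le_linear:
  assumes "1 \<le> m" "Suc m \<le> n" "p \<in> {0..1}"
  shows "bernstein_op (delete_one_jackknife f m) (Suc m) p
    \<le> (h (1 / real n) + 2 * c * real n powr (1 - \<alpha>)) * p"
proof -
  let ?b = "h (1 / real n) + 2 * c * real n powr (1 - \<alpha>)"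
  have "bernstein_op (delete_one_jackknife f m) (Suc m) p \<le> bernstein_op (\<lambda>x. ?b * x) (Suc m) p"
    using assms by (intro bernstein_op_mono delete_one_jackknife_le_linear)
  also have "\<dots> = ?b * p"
    by (simp add: bernstein_op_cmult bernstein_op_ident)
  finally show ?thesis .
qed

lemma abs_jackknife2_bias_le:
  assumes "0 < n1" "n1 < n2" "n2 \<le> n" "p \<in> {0..1}"
  shows "\<bar>jackknife2_bias f n n1 n2 p\<bar> \<le> (1 / \<alpha> + 2) * c / real n1 powr \<alpha>"
proof -
  let ?b = "(1 / \<alpha> + 2) * c / real n1 powr \<alpha>"
  have error: "c / \<alpha> / real (Suc m) powr \<alpha> \<le> ?b" "2 * c / real (Suc m) powr \<alpha> \<le> ?b"
    if "m \<in> {n1..<n2}" for m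
  proof -
    have "real n1 powr \<alpha> \<le> real (Suc m) powr \<alpha>"
      using that exponent by (intro powr_mono2) auto
    then show "c / \<alpha> / real (Suc m) powr \<alpha> \<le> ?b" "2 * c / real (Suc m) powr \<alpha> \<le> ?b"
      using assms(1) exponent scale by (intro frac_le; simp add: distrib_right)+
  qed
  have "jackknife2_bias f n n1 n2 p \<le> ?b"
  proof (rule jackknife2_bias_le)
    fix m assume m: "m \<in> {n1..<n2}"
    then show "bernstein_op (delete_one_jackknife f m) (Suc m) p \<le> f p + ?b"
      using bernstein_op_delete_one_jackknife_le[of m p] error(2)[OF m] assms by simp
  qed (use assms in auto)
  moreover have "- ?b \<le> jackknife2_bias f n n1 n2 p"
  proof (rule jackknife2_bias_ge)
    fix m assume m: "m \<in> {n1..<n2}"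
    then show "f p + - ?b \<le> bernstein_op (delete_one_jackknife f m) (Suc m) p"
      using bernstein_op_delete_one_jackknife_ge[of m p] error(1)[OF m] assms by simp
  qed (use assms in auto)
  ultimately show ?thesis
    by (simp add: abs_le_iff)
qed

lemma jackknife2_bias_near_zero:
  assumes "0 < n1" "n1 < n2" "n2 \<le> n"
  shows "\<exists>p\<in>{0..1}. jackknife2_bias f n n1 n2 p \<le> - (exp (- 3) * c / real n powr \<alpha>)"
proof
  let ?slope = "h (1 / real n) + 2 * c * real n powr (1 - \<alpha>)"
  define p where "p = exp (- 3) / real n"
  have n: "1 \<le> real n"
    using assms by simp
  show p: "p \<in> {0..1}"
    using n frac_le[of 1 "exp (- 3)" 1 "real n"] by (simp add: p_def)
  have "c * (1 / real n) powr (\<alpha> - 1) * ln (1 / real n / p) \<le> h p - h (1 / real n)"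
    unfolding p_def using n by (intro h_diff_ge_ln divide_right_mono) auto
  moreover have "ln (1 / real n / p) = 3"
    using n by (simp add: p_def exp_minus inverse_eq_divide)
  moreover have "(1 / real n) powr (\<alpha> - 1) = real n powr (1 - \<alpha>)"
    using n by (simp add: powr_divide powr_diff)
  ultimately have "?slope \<le> h p - c * real n powr (1 - \<alpha>)"
    by simp
  then have "?slope * p \<le> (h p - c * real n powr (1 - \<alpha>)) * p"
    using p by (intro mult_right_mono) auto
  also have "\<dots> = f p - c * (real n powr (1 - \<alpha>) * p)"
    using p by (simp add: f_eq algebra_simps)
  also have "real n powr (1 - \<alpha>) * p = exp (- 3) / real n powr \<alpha>"
    using n by (simp add: p_def powr_diff)
  finally have slope_le: "?slope * p \<le> f p + - (exp (- 3) * c / real n powr \<alpha>)"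
    by (simp add: mult.commute)
  show "jackknife2_bias f n n1 n2 p \<le> - (exp (- 3) * c / real n powr \<alpha>)"
  proof (rule jackknife2_bias_le[OF p assms])
    fix m assume "m \<in> {n1..<n2}"
    then have "1 \<le> m" "Suc m \<le> n"
      using assms by auto
    from bernstein_op_delete_one_jackknife_le_linear[OF this p] slope_le
    show "bernstein_op (delete_one_jackknife f m) (Suc m) p
        \<le> f p + - (exp (- 3) * c / real n powr \<alpha>)"
      by (rule order_trans)
  qed
qed

lemma sup_norm_jackknife2_bias_le:
  assumes "0 < n1" "n1 < n2" "n2 \<le> n"
  shows "sup_norm (jackknife2_bias f n n1 n2) \<le> (1 / \<alpha> + 2) * c / real n1 powr \<alpha>"
  unfolding sup_norm_def by (intro cSUP_least abs_jackknife2_bias_le assms) auto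

lemma sup_norm_jackknife2_bias_ge:
  assumes "0 < n1" "n1 < n2" "n2 \<le> n"
  shows "exp (- 3) * c / real n powr \<alpha> \<le> sup_norm (jackknife2_bias f n n1 n2)"
proof -
  obtain p where p: "p \<in> {0..1}"
    and "jackknife2_bias f n n1 n2 p \<le> - (exp (- 3) * c / real n powr \<alpha>)"
    using jackknife2_bias_near_zero[OF assms] by blast
  then have "exp (- 3) * c / real n powr \<alpha> \<le> \<bar>jackknife2_bias f n n1 n2 p\<bar>"
    by simp
  also have "\<dots> \<le> sup_norm (jackknife2_bias f n n1 n2)"
    unfolding sup_norm_def using p abs_jackknife2_bias_le[OF assms]
    by (intro cSUP_upper bdd_aboveI2)
  finally show ?thesis .
qed

theorem jackknife2_rate_upper:
  assumes "0 < K"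
  shows "\<exists>M>0. \<forall>n n1 n2. admissible K n n1 n2 \<longrightarrow>
    sup_norm (jackknife2_bias f n n1 n2) \<le> M * (1 / real n powr \<alpha>)"
proof (intro exI conjI allI impI)
  show "0 < (1 / \<alpha> + 2) * c * K powr \<alpha>"
    using assms exponent scale by (simp add: add_pos_pos)
  fix n n1 n2 assume "admissible K n n1 n2"
  then have adm: "0 < n1" "n1 < n2" "n2 \<le> n" "real n \<le> K * real n1"
    by (auto simp: admissible_def)
  have "real n powr \<alpha> \<le> K powr \<alpha> * real n1 powr \<alpha>"
    using powr_mono2[OF _ _ adm(4), of \<alpha>] assms exponent by (simp add: powr_mult)
  then have "1 / real n1 powr \<alpha> \<le> K powr \<alpha> * (1 / real n powr \<alpha>)"
    using adm by (simp add: field_simps)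
  then have "(1 / \<alpha> + 2) * c * (1 / real n1 powr \<alpha>)
      \<le> (1 / \<alpha> + 2) * c * (K powr \<alpha> * (1 / real n powr \<alpha>))"
    using exponent scale by (intro mult_left_mono) auto
  with sup_norm_jackknife2_bias_le[OF adm(1-3)]
  show "sup_norm (jackknife2_bias f n n1 n2) \<le> (1 / \<alpha> + 2) * c * K powr \<alpha> * (1 / real n powr \<alpha>)"
    by (simp add: mult.assoc)
qed

theorem jackknife2_rate_lower:
  "\<exists>M>0. \<forall>n n1 n2. 0 < n1 \<and> n1 < n2 \<and> n2 \<le> n \<longrightarrow>
    1 / real n powr \<alpha> \<le> M * sup_norm (jackknife2_bias f n n1 n2)"
proof (intro exI conjI allI impI)
  show "0 < 1 / (exp (- 3) * c)"
    using scale by simp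
  fix n n1 n2 :: nat
  assume "0 < n1 \<and> n1 < n2 \<and> n2 \<le> n"
  then have "exp (- 3) * c / real n powr \<alpha> \<le> sup_norm (jackknife2_bias f n n1 n2)"
    by (intro sup_norm_jackknife2_bias_ge) auto
  then show "1 / real n powr \<alpha> \<le> 1 / (exp (- 3) * c) * sup_norm (jackknife2_bias f n n1 n2)"
    using scale by (simp add: pos_le_divide_eq mult.commute)
qed

end

lemma power_singularity_neg_p_ln_p: "power_singularity neg_p_ln_p (\<lambda>x. - ln x) 1 1"
  by unfold_locales
    (auto intro!: derivative_eq_intros simp: neg_p_ln_p_def powr_minus_divide)

lemma power_singularity_powr:
  assumes "0 < \<alpha>" "\<alpha> < 1"
  shows "power_singularity (\<lambda>x. x powr \<alpha>) (\<lambda>x. x powr (\<alpha> - 1)) \<alpha> (1 - \<alpha>)"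
proof
  fix x :: real
  show "x powr \<alpha> = x * x powr (\<alpha> - 1)" if "0 \<le> x"
    using that by (simp add: powr_mult_base)
  show "((\<lambda>x. x powr (\<alpha> - 1)) has_real_derivative - (1 - \<alpha>) * x powr (\<alpha> - 2)) (at x)" if "0 < x"
    using has_real_derivative_powr[OF that, of "\<alpha> - 1"] by simp
qed (use assms in auto)

lemma sample_sizes_ordered:
  assumes "delete_one n n1 n2 \<or> (admissible K n n1 n2 \<and> bounded_coeffs C n1 n2)"
  shows "0 < n1 \<and> n1 < n2 \<and> n2 \<le> n"
  using assms by (auto simp: delete_one_def admissible_def)

theorem theorem6:
  fixes K C :: real
  assumes "K > 0"
  shows
    "(\<exists>M>0. \<forall>n n1 n2. admissible K n n1 n2 \<longrightarrow>
        sup_norm (jackknife2_bias neg_p_ln_p n n1 n2) \<le> M * (1 / real n)) \<and>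
     (\<forall>\<alpha>. 0 < \<alpha> \<and> \<alpha> < 1 \<longrightarrow>
       (\<exists>M>0. \<forall>n n1 n2. admissible K n n1 n2 \<longrightarrow>
          sup_norm (jackknife2_bias (\<lambda>p. p powr \<alpha>) n n1 n2) \<le> M * (1 / real n powr \<alpha>))) \<and>
     (\<exists>M>0. \<forall>n n1 n2.
        delete_one n n1 n2 \<or> (admissible K n n1 n2 \<and> bounded_coeffs C n1 n2) \<longrightarrow>
        1 / real n \<le> M * sup_norm (jackknife2_bias neg_p_ln_p n n1 n2)) \<and>
     (\<forall>\<alpha>. 0 < \<alpha> \<and> \<alpha> < 1 \<longrightarrow>
       (\<exists>M>0. \<forall>n n1 n2.
          delete_one n n1 n2 \<or> (admissible K n n1 n2 \<and> bounded_coeffs C n1 n2) \<longrightarrow>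
          1 / real n powr \<alpha> \<le> M * sup_norm (jackknife2_bias (\<lambda>p. p powr \<alpha>) n n1 n2)))"
proof (intro conjI allI impI)
  interpret entropy: power_singularity neg_p_ln_p "\<lambda>x. - ln x" 1 1
    by (rule power_singularity_neg_p_ln_p)
  show "\<exists>M>0. \<forall>n n1 n2. admissible K n n1 n2 \<longrightarrow>
      sup_norm (jackknife2_bias neg_p_ln_p n n1 n2) \<le> M * (1 / real n)"
    using entropy.jackknife2_rate_upper[OF assms] by simp
  have "\<exists>M>0. \<forall>n n1 n2. 0 < n1 \<and> n1 < n2 \<and> n2 \<le> n \<longrightarrow>
      1 / real n \<le> M * sup_norm (jackknife2_bias neg_p_ln_p n n1 n2)"
    using entropy.jackknife2_rate_lower by simp
  with sample_sizes_ordered show "\<exists>M>0. \<forall>n n1 n2.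
      delete_one n n1 n2 \<or> (admissible K n n1 n2 \<and> bounded_coeffs C n1 n2) \<longrightarrow>
      1 / real n \<le> M * sup_norm (jackknife2_bias neg_p_ln_p n n1 n2)"
    by meson
  fix \<alpha> :: real
  assume "0 < \<alpha> \<and> \<alpha> < 1"
  then interpret power: power_singularity "\<lambda>x. x powr \<alpha>" "\<lambda>x. x powr (\<alpha> - 1)" \<alpha> "1 - \<alpha>"
    by (intro power_singularity_powr) auto
  show "\<exists>M>0. \<forall>n n1 n2. admissible K n n1 n2 \<longrightarrow>
      sup_norm (jackknife2_bias (\<lambda>p. p powr \<alpha>) n n1 n2) \<le> M * (1 / real n powr \<alpha>)"
    by (rule power.jackknife2_rate_upper[OF assms])
  show "\<exists>M>0. \<forall>n n1 n2.
      delete_one n n1 n2 \<or> (admissible K n n1 n2 \<and> bounded_coeffs C n1 n2) \<longrightarrow>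
      1 / real n powr \<alpha> \<le> M * sup_norm (jackknife2_bias (\<lambda>p. p powr \<alpha>) n n1 n2)"
    using power.jackknife2_rate_lower sample_sizes_ordered by meson
qed

end
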